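(* Consider the exo-system $\dot w(t)=s(w(t))$, $w(0)=w_0$, generating the supply/demand $Pw(t)$ of the inventory network $\dot x = B\lambda + Pw$. Suppose that: (A1) there is a compact set $\mathcal{W}\subset\mathbb{R}^r$ that is forward invariant under $\dot w=s(w)$, and the initial conditions $w(0)$ are contained in $\mathcal{W}$; and that, for the solutions $w(t)$ with $w(0)\in\mathcal{W}$, (A2) $\mathbf{1}_n^TPw(t)=0$ for all $t\ge0$; (A3) there exists $\epsilon>0$ such that for every nonempty proper subset $S\subset V$ and all $t\ge0$, $$-\bar\lambda_{Q(S)}+\epsilon\le\sum_{i\in S}[Pw(t)]_i\le\bar\lambda_{Q(S)}-\epsilon;$$ (A4) the cost functions $\mathcal{P}_1,\dots,\mathcal{P}_m$ are of Legendre type in the sense given in the context. Then there exist functions $\Phi:\mathbb{R}^n\times\mathbb{R}^r\to\mathbb{R}^n$ and $\Psi:\mathbb{R}^n\to\mathbb{R}^m$ such that for any solution $w(t)$ of $\dot w=s(w)$ with $w(0)=w_0\in\mathcal{W}$ there exists $\zeta^w(0)\in\mathbb{R}^n$ such that the solution $\zeta^w(t)$ of the dynamical system $$\dot\zeta=\Phi(\zeta,w),\qquad \lambda=\Psi(\zeta)$$ originating at $\zeta^w(0)$ is such that $\lambda^w(t)=\Psi(\zeta^w(t))$ satisfies $(\lambda^w(t),w(t))\in\Gamma$ for all $t\ge0$.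
   Context: **Network.** $\mathcal{G}=(V,E)$ is a graph with $|V|=n$ nodes (inventories) and $|E|=m$ edges (transportation lines) with an arbitrary fixed orientation. $B\in\mathbb{R}^{n\times m}$ is its incidence matrix: $[B]_{ik}=+1$ if node $i$ is the initial node of edge $k$, $-1$ if it is the terminal node, $0$ otherwise. $\mathbf{1}_n$ is the all-ones vector in $\mathbb{R}^n$ and $\mathcal{R}(\cdot)$ denotes the range of a matrix. **Inventory system.** $x\in\mathbb{R}^n$ is the storage level, $\lambda\in\mathbb{R}^m$ the flow along the lines, $P\in\mathbb{R}^{n\times r}$ a given matrix, and $w\in\mathbb{R}^r$ the state of the exo-system $\dot w=s(w)$, where $s:\mathbb{R}^r\to\mathbb{R}^r$ is a given vector field. Solutions $w(t)$ starting in $\mathcal{W}$ are understood to be continuously differentiable and defined for all $t\ge0$. **Capacities and cuts.** Each line $k$ has a capacity $\bar\lambda_k\in(0,\infty]$ ($\bar\lambda_k=\infty$ if line $k$ is unconstrained). For $S\subseteq V$, the cut $Q(S)$ induced by $S$ is the set of all edges having exactly one endpoint in $S$, and its capacity is $\bar\lambda_{Q(S)}=\sum_{k\in Q(S)}\bar\lambda_k$. **Cost functions (Legendre type).** For each $k$, $\mathcal{P}_k$ is a convex function with $\mathcal{P}_k(\lambda_k)=\infty$ for $|\lambda_k|>\bar\lambda_k$; it is $C^\infty$ and strictly convex on the open interval $(-\bar\lambda_k,\bar\lambda_k)$, and $\lim_{\ell\to\infty}|\nabla\mathcal{P}_k(\lambda_k^{[\ell]})|=+\infty$ for every sequence with $|\lambda_k^{[\ell]}|<\bar\lambda_k$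 and $\lim_{\ell\to\infty}|\lambda_k^{[\ell]}|=\bar\lambda_k$. Hence $\nabla\mathcal{P}_k$ is invertible on $(-\bar\lambda_k,\bar\lambda_k)$, with inverse $\nabla\mathcal{P}_k^{-1}:\mathbb{R}\to(-\bar\lambda_k,\bar\lambda_k)$. It is also assumed that the derivative of $\nabla\mathcal{P}_k^{-1}$ exists, is strictly positive and is continuously differentiable. Write $\mathcal{P}(\lambda)=\sum_{k=1}^m\mathcal{P}_k(\lambda_k)$. **Optimal routing set.** $$\Gamma=\{(\lambda,w)\in\mathbb{R}^m\times\mathcal{W}\,:\,\nabla\mathcal{P}(\lambda)\in\mathcal{R}(B^T),\ B\lambda+Pw=0\},$$ where $\lambda$ ranges over points with $|\lambda_k|<\bar\lambda_k$ for all $k$, so that $\nabla\mathcal{P}(\lambda)$ is defined. ($(\lambda,w)\in\Gamma$ means that $\lambda$ minimizes $\mathcal{P}$ subject to $B\lambda+Pw=0$.) *)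

theory Defs
  imports "HOL-Analysis.Analysis"
begin

text \<open>
  An oriented graph is given by the maps \<open>src\<close> and \<open>tgt\<close> from the finite edge type to the finite
  node type. Parallel edges are allowed; self-loops are excluded where the graph is introduced.
\<close>

definition incidence :: "('m \<Rightarrow> 'n) \<Rightarrow> ('m \<Rightarrow> 'n) \<Rightarrow> real ^ 'm ^ 'n" where
  "incidence src tgt = (\<chi> i k. if i = src k then 1 else if i = tgt k then - 1 else 0)"

definition cut :: "('m \<Rightarrow> 'n) \<Rightarrow> ('m \<Rightarrow> 'n) \<Rightarrow> 'n set \<Rightarrow> 'm set" where
  "cut src tgt S = {k. (src k \<in> S) \<noteq> (tgt k \<in> S)}"

definition cut_capacity ::
  "('m \<Rightarrow> 'n) \<Rightarrow> ('m \<Rightarrow> 'n) \<Rightarrow> ('m \<Rightarrow> ereal) \<Rightarrow> 'n set \<Rightarrow> ereal" where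
  "cut_capacity src tgt cap S = (\<Sum>k\<in>cut src tgt S. cap k)"

text \<open>
  Solutions live on the closed half line \<open>t \<ge> 0\<close>; at \<open>t = 0\<close> the derivative is one-sided.
\<close>

definition ode_solution ::
  "(real \<Rightarrow> 'a \<Rightarrow> 'a) \<Rightarrow> (real \<Rightarrow> 'a::real_normed_vector) \<Rightarrow> bool" where
  "ode_solution f x \<longleftrightarrow>
     (\<forall>t\<ge>0. (x has_vector_derivative f t (x t)) (at t within {0..}))"

text \<open>
  The vector field \<open>s\<close> need not be continuous, so continuity of the derivative of a solution is
  a separate requirement.
\<close>

definition exo_solution ::
  "('a \<Rightarrow> 'a) \<Rightarrow> (real \<Rightarrow> 'a::real_normed_vector) \<Rightarrow> bool" where
  "exo_solution s w \<longleftrightarrow> ode_solution (\<lambda>t. s) w \<and> continuous_on {0..} (\<lambda>t. s (w t))"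

definition forward_invariant ::
  "('a \<Rightarrow> 'a) \<Rightarrow> ('a::real_normed_vector) set \<Rightarrow> bool" where
  "forward_invariant s W \<longleftrightarrow>
     (\<forall>w. exo_solution s w \<and> w 0 \<in> W \<longrightarrow> (\<forall>t\<ge>0. w t \<in> W))"

text \<open>
  Cost functions take values in the extended reals. Convexity of such a function is convexity of
  its epigraph (the library's \<open>convex_on\<close> covers real-valued functions only).
\<close>

definition ext_convex :: "(real \<Rightarrow> ereal) \<Rightarrow> bool" where
  "ext_convex F \<longleftrightarrow> convex {(x, y :: real). F x \<le> ereal y}"

definition strictly_convex_on :: "real set \<Rightarrow> (real \<Rightarrow> real) \<Rightarrow> bool" where
  "strictly_convex_on I f \<longleftrightarrow>
     (\<forall>x\<in>I. \<forall>y\<in>I. \<forall>u. x \<noteq> y \<and> 0 < u \<and> u < 1 \<longrightarrow>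
        f ((1 - u) * x + u * y) < (1 - u) * f x + u * f y)"

text \<open>Intended for open \<open>I\<close>, where the iterates of \<open>deriv\<close> are the derivatives of all orders.\<close>

definition smooth_on :: "real set \<Rightarrow> (real \<Rightarrow> real) \<Rightarrow> bool" where
  "smooth_on I f \<longleftrightarrow> (\<forall>j. \<forall>x\<in>I. (deriv ^^ j) f field_differentiable (at x))"

definition cap_interval :: "ereal \<Rightarrow> real set" where
  "cap_interval c = {x. ereal \<bar>x\<bar> < c}"

definition cost_deriv :: "(real \<Rightarrow> ereal) \<Rightarrow> real \<Rightarrow> real" where
  "cost_deriv F = deriv (\<lambda>x. real_of_ereal (F x))"

text \<open>
  In the last two clauses \<open>inv_into\<close> is the genuine inverse of the derivative: the preceding
  clauses make \<open>cost_deriv F\<close> a bijection from \<open>cap_interval c\<close> onto the reals.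
\<close>

definition legendre_type :: "ereal \<Rightarrow> (real \<Rightarrow> ereal) \<Rightarrow> bool" where
  "legendre_type c F \<longleftrightarrow>
     ext_convex F \<and>
     (\<forall>x. c < ereal \<bar>x\<bar> \<longrightarrow> F x = \<infinity>) \<and>
     (\<forall>x\<in>cap_interval c. \<bar>F x\<bar> \<noteq> \<infinity>) \<and>
     smooth_on (cap_interval c) (\<lambda>x. real_of_ereal (F x)) \<and>
     strictly_convex_on (cap_interval c) (\<lambda>x. real_of_ereal (F x)) \<and>
     (\<forall>l :: nat \<Rightarrow> real.
        (\<forall>i. l i \<in> cap_interval c) \<and> (\<lambda>i. ereal \<bar>l i\<bar>) \<longlonglongrightarrow> c \<longrightarrow>
        filterlim (\<lambda>i. \<bar>cost_deriv F (l i)\<bar>) at_top sequentially) \<and>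
     (\<forall>y. inv_into (cap_interval c) (cost_deriv F) field_differentiable (at y) \<and>
          0 < deriv (inv_into (cap_interval c) (cost_deriv F)) y) \<and>
     deriv (inv_into (cap_interval c) (cost_deriv F)) C1_differentiable_on UNIV"

definition total_cost :: "('m \<Rightarrow> real \<Rightarrow> ereal) \<Rightarrow> real ^ 'm \<Rightarrow> ereal" where
  "total_cost F l = (\<Sum>k\<in>UNIV. F k (l $ k))"

definition optimal_routing ::
  "('m::finite \<Rightarrow> 'n::finite) \<Rightarrow> ('m \<Rightarrow> 'n) \<Rightarrow> ('m \<Rightarrow> ereal) \<Rightarrow> ('m \<Rightarrow> real \<Rightarrow> ereal) \<Rightarrow>
   real ^ 'r::finite ^ 'n \<Rightarrow> (real ^ 'r) set \<Rightarrow> ((real ^ 'm) \<times> (real ^ 'r)) set" where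
  "optimal_routing src tgt cap F P W =
     {(l, w). w \<in> W \<and>
        (\<forall>k. l $ k \<in> cap_interval (cap k)) \<and>
        (\<exists>g \<in> range (\<lambda>\<eta>. transpose (incidence src tgt) *v \<eta>).
           GDERIV (\<lambda>x. real_of_ereal (total_cost F x)) l :> g) \<and>
        incidence src tgt *v l + P *v w = 0}"

end

theory Submission
  imports Defs
begin

text \<open>
  A routing is optimal when the marginal costs of the lines are the differences of some node
  potential \<open>\<eta>\<close>. Inverting the marginal costs, with inverse \<open>h k\<close> on line \<open>k\<close>, a potential
  determines the flow \<open>\<lambda> k = h k (\<eta> (src k) - \<eta> (tgt k))\<close>, which respects the capacities and satisfies
  the optimality condition by construction. This is the output map \<open>\<Psi>\<close>. What remains is the balance
  equation \<open>B \<lambda> + P w = 0\<close>, an equation for the potential. Grounding the potential at a reference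
  node turns it into \<open>G \<eta> = - P w\<close> for the map \<open>G = outflow h r\<close>, whose domain and codomain have
  the same dimension.

  The equation is solvable whenever the supply is balanced and strictly inside the cut bounds
  (\<open>outflow_attains\<close>). By Brouwer's theorem it suffices that \<open>G \<eta> + P w\<close> points outwards on a large
  sphere. For large potential differences a line carries nearly its capacity (any prescribed
  amount, if the capacity is infinite), so up to a constant
  the pairing of \<open>G \<eta>\<close> with \<open>\<eta>\<close> dominates the variation of \<open>\<eta>\<close> weighted by capacities. Integrating
  the cut condition over the superlevel sets of \<open>\<eta>\<close> (\<open>cut_integral\<close>) shows that this variation
  outweighs the pairing with \<open>P w\<close>; the cut condition plays the part that it has in
  max-flow min-cut duality.

  The strict cut bounds also make the network connected, and the \<open>h k\<close> have positive derivative, so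
  both \<open>G\<close> and its derivative are injective, and the inverse \<open>E\<close> of \<open>G\<close> is differentiable at each
  attained value (\<open>inv_outflow_differentiable\<close>). Along a supply trajectory \<open>\<zeta> t = E (- P (w t))\<close>
  is then a differentiable choice of potentials, and the chain rule gives
  \<open>\<zeta>' = - E'(- P w) (P (s w))\<close>. The right-hand side is a function of \<open>w\<close> alone and serves as \<open>\<Phi>\<close>.
  Consequently two solutions with the same initial value differ by a function of zero derivative,
  hence coincide.
\<close>

section \<open>Capacity intervals\<close>

lemma cap_interval_cases:
  obtains (bounded) r where "c = ereal r" "cap_interval c = {-r<..<r}"
  | (unbounded) "c = \<infinity>" "cap_interval c = UNIV"
  | (empty) "c = -\<infinity>" "cap_interval c = {}"
  by (cases c) (force simp: cap_interval_def abs_less_iff)+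

lemma open_cap_interval: "open (cap_interval c)"
  by (cases c rule: cap_interval_cases) auto

lemma convex_cap_interval: "convex (cap_interval c)"
  by (cases c rule: cap_interval_cases) auto

lemma zero_in_cap_interval: "0 < c \<Longrightarrow> 0 \<in> cap_interval c"
  by (simp add: cap_interval_def zero_ereal_def)

lemma uminus_in_cap_interval: "x \<in> cap_interval c \<Longrightarrow> - x \<in> cap_interval c"
  by (simp add: cap_interval_def)

text \<open>
  Steepness of a Legendre cost is stated along sequences tending to the capacity; this provides one
  uniformly for finite and infinite capacity.
\<close>

lemma exhausting_sequence:
  assumes "0 < c"
  obtains l :: "nat \<Rightarrow> real"
  where "\<And>i. 0 \<le> l i" "\<And>i. l i \<in> cap_interval c" "(\<lambda>i. ereal (l i)) \<longlonglongrightarrow> c"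
proof (cases c rule: cap_interval_cases)
  case (bounded r)
  have "(\<lambda>i. r * (1 - 1 / real (Suc i))) \<longlonglongrightarrow> r * (1 - 0)"
    by (intro tendsto_intros LIMSEQ_inverse_real_of_nat[unfolded inverse_eq_divide])
  moreover have pos: "0 < r" using assms bounded by simp
  moreover have "0 \<le> 1 - 1 / real (Suc i)" "1 - 1 / real (Suc i) < 1" for i
    by simp_all
  then have below: "0 \<le> r * (1 - 1 / real (Suc i))" "r * (1 - 1 / real (Suc i)) < r" for i
    using pos mult_strict_left_mono[of "1 - 1 / real (Suc i)" 1 r]
    by (simp_all only: zero_le_mult_iff less_imp_le mult_1_right) simp_all
  ultimately have "(\<lambda>i. ereal (r * (1 - 1 / real (Suc i)))) \<longlonglongrightarrow> c"
    using bounded by simp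
  moreover have "r * (1 - 1 / real (Suc i)) \<in> cap_interval c" for i
    using below[of i] pos unfolding bounded(2) greaterThanLessThan_iff by linarith
  ultimately show ?thesis
    using below(1) by (intro that[of "\<lambda>i. r * (1 - 1 / real (Suc i))"])
next
  case unbounded
  have "(\<lambda>i. ereal (real i)) \<longlonglongrightarrow> \<infinity>"
    using id_nat_ereal_tendsto_PInf by simp
  then show ?thesis using unbounded by (intro that[of real]) auto
next
  case empty
  then show ?thesis using assms by simp
qed

section \<open>Marginal costs and their inverses\<close>

locale legendre_cost =
  fixes c :: ereal and F :: "real \<Rightarrow> ereal"
  assumes cap_pos: "0 < c" and legendre: "legendre_type c F"
begin

abbreviation D :: "real \<Rightarrow> real" where "D \<equiv> cost_deriv F"

abbreviation h :: "real \<Rightarrow> real" where "h \<equiv> inv_into (cap_interval c) D"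

lemma F_finite: "x \<in> cap_interval c \<Longrightarrow> \<bar>F x\<bar> \<noteq> \<infinity>"
  using legendre unfolding legendre_type_def by metis

lemma cost_has_deriv:
  assumes "x \<in> cap_interval c"
  shows "((\<lambda>x. real_of_ereal (F x)) has_real_derivative D x) (at x)"
proof -
  have "smooth_on (cap_interval c) (\<lambda>x. real_of_ereal (F x))"
    using legendre unfolding legendre_type_def by blast
  then have "(deriv ^^ 0) (\<lambda>x. real_of_ereal (F x)) field_differentiable at x"
    using assms unfolding smooth_on_def by blast
  then show ?thesis
    by (simp add: cost_deriv_def DERIV_deriv_iff_field_differentiable)
qed

lemma continuous_on_D: "continuous_on (cap_interval c) D"
proof -
  have "smooth_on (cap_interval c) (\<lambda>x. real_of_ereal (F x))"
    using legendre unfolding legendre_type_def by blast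
  then have "\<forall>x\<in>cap_interval c. (deriv ^^ 1) (\<lambda>x. real_of_ereal (F x)) field_differentiable at x"
    unfolding smooth_on_def by blast
  then show ?thesis
    unfolding cost_deriv_def
    by (auto intro!: continuous_at_imp_continuous_on field_differentiable_imp_continuous_at)
qed

lemma convex_on_cost: "convex_on (cap_interval c) (\<lambda>x. real_of_ereal (F x))"
proof (rule convex_onI[OF _ convex_cap_interval])
  fix t x y :: real
  assume t: "0 < t" "t < 1" and xy: "x \<in> cap_interval c" "y \<in> cap_interval c"
  have "strictly_convex_on (cap_interval c) (\<lambda>x. real_of_ereal (F x))"
    using legendre unfolding legendre_type_def by blast
  then show "real_of_ereal (F ((1 - t) *\<^sub>R x + t *\<^sub>R y))
      \<le> (1 - t) * real_of_ereal (F x) + t * real_of_ereal (F y)"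
    using t xy unfolding strictly_convex_on_def
    by (cases "x = y") (force simp: algebra_simps less_imp_le)+
qed

lemma mono_on_D:
  assumes "x \<in> cap_interval c" "y \<in> cap_interval c" "x \<le> y"
  shows "D x \<le> D y"
proof (cases "x = y")
  case False
  have tangent: "real_of_ereal (F v) - real_of_ereal (F u) \<ge> D u * (v - u)"
    if "u \<in> cap_interval c" "v \<in> cap_interval c" for u v
    using that open_cap_interval convex_cap_interval
    by (intro convex_on_imp_above_tangent[OF convex_on_cost])
      (auto simp: interior_open convex_connected intro: DERIV_subset[OF cost_has_deriv])
  have "D x * (y - x) \<le> D y * (y - x)"
    using tangent[of x y] tangent[of y x] assms by (simp add: algebra_simps)
  then show ?thesis using False assms(3) by (simp add: mult_le_cancel_right)
qed simp

text \<open>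
  Steepness only makes the absolute value of the marginal cost blow up. Monotonicity fixes the sign:
  along a nonnegative sequence the marginal cost stays above its value at zero, so it blows up
  to \<open>+\<infinity>\<close>, and along the mirrored sequence to \<open>-\<infinity>\<close>.
\<close>

lemma D_reaches_above: "\<exists>x\<in>cap_interval c. y < D x"
  and D_reaches_below: "\<exists>x\<in>cap_interval c. D x < y"
proof -
  obtain l where l: "\<And>i. 0 \<le> l i" "\<And>i. l i \<in> cap_interval c" "(\<lambda>i. ereal (l i)) \<longlonglongrightarrow> c"
    using exhausting_sequence[OF cap_pos] by blast
  have steep: "filterlim (\<lambda>i. \<bar>D (u i)\<bar>) at_top sequentially"
    if "\<forall>i. u i \<in> cap_interval c" "(\<lambda>i. ereal \<bar>u i\<bar>) \<longlonglongrightarrow> c" for u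
    using legendre that unfolding legendre_type_def by blast
  let ?b = "max \<bar>y\<bar> \<bar>D 0\<bar> + 1"
  have "filterlim (\<lambda>i. \<bar>D (l i)\<bar>) at_top sequentially"
    using l by (intro steep) simp_all
  then obtain i where i: "?b \<le> \<bar>D (l i)\<bar>"
    unfolding filterlim_at_top by (meson eventually_sequentially le_refl)
  moreover have "D 0 \<le> D (l i)"
    using l zero_in_cap_interval[OF cap_pos] by (intro mono_on_D)
  ultimately have "y < D (l i)" by linarith
  then show "\<exists>x\<in>cap_interval c. y < D x" using l by blast
  have "filterlim (\<lambda>i. \<bar>D (- l i)\<bar>) at_top sequentially"
    using l uminus_in_cap_interval by (intro steep) simp_all
  then obtain j where j: "?b \<le> \<bar>D (- l j)\<bar>"
    unfolding filterlim_at_top by (meson eventually_sequentially le_refl)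
  moreover have "D (- l j) \<le> D 0"
    using l zero_in_cap_interval[OF cap_pos] uminus_in_cap_interval by (intro mono_on_D) auto
  ultimately have "D (- l j) < y" by linarith
  then show "\<exists>x\<in>cap_interval c. D x < y" using l uminus_in_cap_interval by blast
qed

lemma D_surj: "y \<in> D ` cap_interval c"
proof -
  obtain u v where uv: "u \<in> cap_interval c" "D u < y" "v \<in> cap_interval c" "y < D v"
    using D_reaches_above D_reaches_below by blast
  have "connected (D ` cap_interval c)"
    by (intro connected_continuous_image continuous_on_D convex_connected convex_cap_interval)
  then show ?thesis
    using uv connectedD_interval[of "D ` cap_interval c" "D u" "D v" y] by auto
qed

lemma h_in: "h y \<in> cap_interval c" and D_h: "D (h y) = y"
  using D_surj by (simp_all add: inv_into_into f_inv_into_f)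

lemma h_has_deriv: "(h has_real_derivative deriv h y) (at y)"
  and deriv_h_pos: "0 < deriv h y"
  using legendre unfolding legendre_type_def DERIV_deriv_iff_field_differentiable by blast+

lemma h_mono: "x \<le> y \<Longrightarrow> h x \<le> h y"
  by (rule DERIV_nonneg_imp_nondecreasing)
    (auto intro: h_has_deriv less_imp_le[OF deriv_h_pos])

lemma h_ge: "a \<in> cap_interval c \<Longrightarrow> D a < y \<Longrightarrow> a \<le> h y"
  using mono_on_D[OF h_in, of a y] D_h[of y] by force

lemma h_le: "a \<in> cap_interval c \<Longrightarrow> y < D a \<Longrightarrow> h y \<le> a"
  using mono_on_D[OF _ h_in, of a y] D_h[of y] by force

text \<open>
  Every value \<open>a\<close> below the capacity is eventually exceeded by the flow \<open>h y\<close>, and \<open>- a\<close> is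
  eventually undershot, so outside a bounded range of potential differences the power \<open>h y * y\<close> is
  at least \<open>a * \<bar>y\<bar>\<close>. In this way the capacities enter the solvability of the flow equations.
\<close>

lemma h_coercive:
  assumes a: "0 \<le> a" "ereal a < c"
  shows "\<exists>C. \<forall>y. a * \<bar>y\<bar> - C \<le> h y * y"
proof -
  define Y where "Y = max \<bar>D a\<bar> \<bar>D (- a)\<bar> + 1"
  \<comment> \<open>Bounds \<open>(\<bar>h y\<bar> + a) * \<bar>y\<bar>\<close> on the range \<open>\<bar>y\<bar> < Y\<close>, by monotonicity of \<open>h\<close>.\<close>
  define C where "C = (\<bar>h Y\<bar> + \<bar>h (- Y)\<bar> + a) * Y"
  have a_in: "a \<in> cap_interval c" "- a \<in> cap_interval c"
    using a by (auto simp: cap_interval_def)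
  have Y: "D a < Y" "- Y < D (- a)" "0 < Y" unfolding Y_def by linarith+
  have C: "0 \<le> C" using a Y unfolding C_def by (intro mult_nonneg_nonneg) auto
  have "a * \<bar>y\<bar> - C \<le> h y * y" for y
  proof -
    consider "Y \<le> y" | "y \<le> - Y" | "\<bar>y\<bar> < Y" by linarith
    then show ?thesis
    proof cases
      case 1
      then have "a * y \<le> h y * y" using Y h_ge[OF a_in(1), of y] by (intro mult_right_mono) auto
      moreover have "\<bar>y\<bar> = y" using 1 Y by simp
      ultimately show ?thesis using C by (metis diff_left_mono diff_zero mult_minus_left mult_minus_right order_trans)
    next
      case 2
      then have "- a * y \<le> h y * y"
        using Y h_le[OF a_in(2), of y] by (intro mult_right_mono_neg) auto
      moreover have "\<bar>y\<bar> = - y" using 2 Y by simp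
      ultimately show ?thesis using C by (metis diff_left_mono diff_zero mult_minus_left mult_minus_right order_trans)
    next
      case 3
      then have "h (- Y) \<le> h y" "h y \<le> h Y" by (auto intro: h_mono)
      then have "\<bar>h y\<bar> \<le> \<bar>h Y\<bar> + \<bar>h (- Y)\<bar>" by linarith
      then have "(a + \<bar>h y\<bar>) * \<bar>y\<bar> \<le> C"
        unfolding C_def using a 3 Y
        by (subst mult.commute, subst (2) mult.commute) (intro mult_mono; simp)
      moreover have "- (\<bar>h y\<bar> * \<bar>y\<bar>) \<le> h y * y"
        by (metis abs_ge_minus_self abs_mult minus_le_iff)
      ultimately show ?thesis by (simp add: algebra_simps)
    qed
  qed
  then show ?thesis by blast
qed

end

section \<open>Zeros of outward pointing fields\<close>

text \<open>
  Brouwer's theorem applied to \<open>x \<mapsto> closest_point (x - f x)\<close> gives a point at which \<open>f x \<bullet> x \<le> f x \<bullet> y\<close>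
  for all \<open>y\<close> in the ball. If \<open>f x\<close> were nonzero, taking \<open>y\<close> antipodal to the direction of \<open>f x\<close>
  would force \<open>f x \<bullet> x \<le> - R * norm (f x)\<close>, that is, \<open>x\<close> on the sphere with \<open>f\<close> pointing inwards.
\<close>

lemma zero_of_outward_field:
  fixes f :: "'a::euclidean_space \<Rightarrow> 'a"
  assumes R: "0 < R" and cont: "continuous_on (cball 0 R) f"
    and outward: "\<And>x. norm x = R \<Longrightarrow> 0 \<le> f x \<bullet> x"
  shows "\<exists>x. f x = 0"
proof -
  let ?C = "cball (0::'a) R"
  have "continuous_on ?C (\<lambda>x. closest_point ?C (x - f x))"
    using R by (intro continuous_on_compose2[OF continuous_on_closest_point[where t = UNIV]]
        continuous_intros cont) auto
  moreover have "(\<lambda>x. closest_point ?C (x - f x)) \<in> ?C \<rightarrow> ?C"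
    using R by (intro Pi_I closest_point_in_set) auto
  ultimately obtain x where x: "x \<in> ?C" "closest_point ?C (x - f x) = x"
    using brouwer[of ?C "\<lambda>x. closest_point ?C (x - f x)"] R by auto
  have variational: "f x \<bullet> x \<le> f x \<bullet> y" if "y \<in> ?C" for y
    using closest_point_dot[of ?C y "x - f x"] that x
    by (simp add: inner_diff_right)
  show ?thesis
  proof (rule ccontr)
    assume "\<nexists>x. f x = 0"
    then have nz: "0 < norm (f x)" by simp
    have "f x \<bullet> x \<le> f x \<bullet> (- (R / norm (f x)) *\<^sub>R f x)"
      using R nz by (intro variational) simp
    also have "\<dots> = - R * norm (f x)"
      using nz by (simp add: dot_square_norm power2_eq_square)
    finally have neg: "f x \<bullet> x \<le> - R * norm (f x)" .
    then have "f x \<bullet> x < 0" using R nz by (smt (verit) mult_minus_left mult_pos_pos)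
    moreover have "norm x = R"
    proof -
      have "R * norm (f x) \<le> norm (f x) * norm x"
        using neg Cauchy_Schwarz_ineq2[of "f x" x] by linarith
      then have "R \<le> norm x" using nz by (simp add: mult.commute)
      then show ?thesis using x by simp
    qed
    ultimately show False using outward[of x] by simp
  qed
qed

section \<open>Cuts and potentials\<close>

locale network =
  fixes src tgt :: "'m::finite \<Rightarrow> 'n::finite"
  assumes no_loops: "src k \<noteq> tgt k"
begin

abbreviation B :: "real ^ 'm ^ 'n" where "B \<equiv> incidence src tgt"

definition diff :: "real ^ 'n \<Rightarrow> 'm \<Rightarrow> real" where
  "diff \<eta> k = \<eta> $ src k - \<eta> $ tgt k"

lemma transpose_incidence: "transpose B *v \<eta> = (\<chi> k. diff \<eta> k)"
proof -
  have "(\<Sum>i\<in>UNIV. B $ i $ k * \<eta> $ i) = diff \<eta> k" for k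
  proof -
    have "(\<Sum>i\<in>UNIV. B $ i $ k * \<eta> $ i)
        = (\<Sum>i\<in>UNIV. (if i = src k then \<eta> $ i else 0) - (if i = tgt k then \<eta> $ i else 0))"
      using no_loops by (intro sum.cong) (auto simp: incidence_def)
    then show ?thesis by (simp add: sum_subtractf diff_def)
  qed
  then show ?thesis
    unfolding matrix_vector_mult_def transpose_def by (simp add: vec_eq_iff)
qed

lemma inner_incidence: "(B *v l) \<bullet> d = (\<Sum>k\<in>UNIV. l $ k * diff d k)"
proof -
  have "(B *v l) \<bullet> d = l \<bullet> (transpose B *v d)"
    by (metis dot_lmul_matrix vector_transpose_matrix)
  then show ?thesis by (simp only: transpose_incidence) (simp add: inner_vec_def)
qed

text \<open>
  A coarea argument. Write the total variation \<open>\<Sum>k. a k * \<bar>diff \<eta> k\<bar>\<close> and the pairing \<open>p \<bullet> \<eta>\<close> as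
  integrals over the level \<open>\<theta>\<close> of the cut weight and of the supply of the superlevel set
  \<open>{w. \<theta> < \<eta> $ w}\<close>. The cut inequality holds for each superlevel set between the minimum and the
  maximum of \<open>\<eta>\<close>, so integrating it bounds the oscillation of \<open>\<eta>\<close>.
\<close>

lemma cut_integral:
  fixes a :: "'m \<Rightarrow> real" and p \<eta> :: "real ^ 'n"
  assumes cuts: "\<And>S. S \<noteq> {} \<Longrightarrow> S \<noteq> UNIV \<Longrightarrow> e \<le> sum a (cut src tgt S) + (\<Sum>i\<in>S. p $ i)"
    and e: "0 \<le> e" and balanced: "(\<Sum>i\<in>UNIV. p $ i) = 0"
  shows "e * \<bar>\<eta> $ i - \<eta> $ j\<bar> \<le> (\<Sum>k\<in>UNIV. a k * \<bar>diff \<eta> k\<bar>) + p \<bullet> \<eta>"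
proof -
  define lo hi where "lo = Min (range (($) \<eta>))" and "hi = Max (range (($) \<eta>))"
  have range: "lo \<le> \<eta> $ v" "\<eta> $ v \<le> hi" for v unfolding lo_def hi_def by simp_all
  have "hi \<in> range (($) \<eta>)" "lo \<in> range (($) \<eta>)"
    unfolding lo_def hi_def by (intro Max_in Min_in; simp)+
  then obtain u v where u: "\<eta> $ u = hi" and v: "\<eta> $ v = lo"
    by auto
  define S where "S \<theta> = {w. \<theta> < \<eta> $ w}" for \<theta>
  have interval: "((\<lambda>\<theta>. if x \<le> \<theta> \<and> \<theta> < y then r else 0) has_integral r * (y - x)) {lo..hi}"
    if "lo \<le> x" "x \<le> y" "y \<le> hi" for x y r :: real
  proof -
    have "((\<lambda>\<theta>. r) has_integral r * (y - x)) {x..y}"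
      using has_integral_const_real[of r x y] that by (simp add: mult.commute)
    then have "((\<lambda>\<theta>. if \<theta> \<in> {x..y} then r else 0) has_integral r * (y - x)) {lo..hi}"
      using has_integral_restrict_closed_subinterval[of "\<lambda>\<theta>. r" "r * (y - x)" x y lo hi] that by simp
    then show ?thesis
      by (rule has_integral_spike_finite[rotated 2, where S = "{y}"]) auto
  qed
  have edge: "((\<lambda>\<theta>. if k \<in> cut src tgt (S \<theta>) then a k else 0) has_integral a k * \<bar>diff \<eta> k\<bar>) {lo..hi}"
    for k
  proof -
    let ?x = "min (\<eta> $ src k) (\<eta> $ tgt k)" and ?y = "max (\<eta> $ src k) (\<eta> $ tgt k)"
    have "(\<lambda>\<theta>. if k \<in> cut src tgt (S \<theta>) then a k else 0) = (\<lambda>\<theta>. if ?x \<le> \<theta> \<and> \<theta> < ?y then a k else 0)"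
      by (auto simp: cut_def S_def fun_eq_iff)
    moreover have "?y - ?x = \<bar>diff \<eta> k\<bar>" by (simp add: diff_def max_def min_def)
    ultimately show ?thesis using interval[of ?x ?y "a k"] range by (simp add: min_le_iff_disj)
  qed
  have node: "((\<lambda>\<theta>. if w \<in> S \<theta> then p $ w else 0) has_integral p $ w * (\<eta> $ w - lo)) {lo..hi}" for w
  proof (rule has_integral_spike_finite[rotated 2, where S = "{}"])
    show "((\<lambda>\<theta>. if lo \<le> \<theta> \<and> \<theta> < \<eta> $ w then p $ w else 0) has_integral p $ w * (\<eta> $ w - lo)) {lo..hi}"
      using range by (intro interval) auto
  qed (auto simp: S_def)
  have "((\<lambda>\<theta>. (\<Sum>k\<in>UNIV. if k \<in> cut src tgt (S \<theta>) then a k else 0) + (\<Sum>w\<in>UNIV. if w \<in> S \<theta> then p $ w else 0))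
      has_integral (\<Sum>k\<in>UNIV. a k * \<bar>diff \<eta> k\<bar>) + (\<Sum>w\<in>UNIV. p $ w * (\<eta> $ w - lo))) {lo..hi}"
    by (intro has_integral_add has_integral_sum edge node) auto
  \<comment> \<open>As the supplies sum to zero, the constant \<open>lo\<close> drops out of the node terms.\<close>
  moreover have "(\<Sum>w\<in>UNIV. p $ w * (\<eta> $ w - lo)) = p \<bullet> \<eta>"
    using balanced by (simp add: inner_vec_def right_diff_distrib sum_subtractf flip: sum_distrib_right)
  ultimately have total: "((\<lambda>\<theta>. sum a (cut src tgt (S \<theta>)) + (\<Sum>w\<in>S \<theta>. p $ w))
      has_integral (\<Sum>k\<in>UNIV. a k * \<bar>diff \<eta> k\<bar>) + p \<bullet> \<eta>) {lo..hi}"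
    by (simp add: sum.If_cases)
  have "e * (hi - lo) \<le> (\<Sum>k\<in>UNIV. a k * \<bar>diff \<eta> k\<bar>) + p \<bullet> \<eta>"
  proof (rule has_integral_le[OF _ total])
    show "((\<lambda>\<theta>. if lo \<le> \<theta> \<and> \<theta> < hi then e else 0) has_integral e * (hi - lo)) {lo..hi}"
      using order_trans[OF range(1) range(2)] by (intro interval) auto
    fix \<theta> assume \<theta>: "\<theta> \<in> {lo..hi}"
    show "(if lo \<le> \<theta> \<and> \<theta> < hi then e else 0) \<le> sum a (cut src tgt (S \<theta>)) + (\<Sum>w\<in>S \<theta>. p $ w)"
    proof (cases "\<theta> < hi")
      case True
      then have "u \<in> S \<theta>" "v \<notin> S \<theta>" using \<theta> u v by (auto simp: S_def)
      then have "e \<le> sum a (cut src tgt (S \<theta>)) + (\<Sum>w\<in>S \<theta>. p $ w)" by (intro cuts) auto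
      then show ?thesis using \<theta> True by simp
    next
      case False
      then have "S \<theta> = {}"
        unfolding S_def using order_trans[OF range(2)] by (auto simp: not_less)
      then show ?thesis using False by (simp add: cut_def)
    qed
  qed
  moreover have "\<bar>\<eta> $ i - \<eta> $ j\<bar> \<le> hi - lo" using range[of i] range[of j] by linarith
  ultimately show ?thesis using e by (meson mult_left_mono order_trans)
qed

lemma diff_injective:
  assumes connected: "\<And>S. S \<noteq> {} \<Longrightarrow> S \<noteq> UNIV \<Longrightarrow> cut src tgt S \<noteq> {}"
    and "\<And>k. diff d k = 0" and "d $ r = 0"
  shows "d = 0"
proof -
  let ?S = "{i. d $ i = 0}"
  have "cut src tgt ?S = {}" using assms(2) by (auto simp: cut_def diff_def)
  then have "?S = UNIV" using connected[of ?S] assms(3) by blast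
  then show ?thesis by (auto simp: vec_eq_iff)
qed

section \<open>The grounded outflow map\<close>

text \<open>
  Node potentials \<open>\<eta>\<close> drive the flow \<open>h k\<close> of the potential difference through each line \<open>k\<close>, and the
  first summand is the net outflow of the nodes. It is invariant under adding constants to \<open>\<eta>\<close> and
  its entries sum to zero, so neither it nor its derivative is invertible. The second summand grounds
  the potential at a reference node \<open>r\<close>; on a connected network with increasing \<open>h k\<close> this makes the
  map injective.
\<close>

definition outflow :: "('m \<Rightarrow> real \<Rightarrow> real) \<Rightarrow> 'n \<Rightarrow> real ^ 'n \<Rightarrow> real ^ 'n" where
  "outflow h r \<eta> = B *v (\<chi> k. h k (diff \<eta> k)) + axis r (\<eta> $ r)"

lemma inner_outflow: "outflow h r \<eta> \<bullet> d = (\<Sum>k\<in>UNIV. h k (diff \<eta> k) * diff d k) + \<eta> $ r * d $ r"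
  by (simp add: outflow_def inner_add_left inner_incidence inner_axis')

text \<open>
  The grounding does not falsify the balance equation: pairing with the all-ones vector leaves only
  \<open>\<eta> $ r\<close>, which therefore vanishes when the right-hand side sums to zero.
\<close>

lemma outflow_balance:
  assumes "outflow h r \<eta> = - p" and "(\<Sum>i\<in>UNIV. p $ i) = 0"
  shows "B *v (\<chi> k. h k (diff \<eta> k)) + p = 0"
proof -
  have "\<eta> $ r = outflow h r \<eta> \<bullet> 1" by (simp add: inner_outflow diff_def)
  also have "\<dots> = 0" using assms by (simp add: inner_vec_def sum_negf)
  finally have "axis r (\<eta> $ r) = 0" by (simp add: axis_def vec_eq_iff)
  then have "B *v (\<chi> k. h k (diff \<eta> k)) = - p"
    using assms(1) by (simp only: outflow_def add_0_right)
  then show ?thesis by simp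
qed

lemma has_derivative_outflow:
  assumes "\<And>k y. (h k has_real_derivative h' k y) (at y)"
  shows "(outflow h r has_derivative outflow (\<lambda>k z. h' k (diff \<eta> k) * z) r) (at \<eta>)"
proof -
  have [derivative_intros]: "((\<lambda>\<eta>. diff \<eta> k) has_derivative (\<lambda>d. diff d k)) (at \<eta>)" for k
    unfolding diff_def
    by (intro bounded_linear_imp_has_derivative bounded_linear_sub bounded_linear_vec_nth)
  have "((\<lambda>\<eta>. h k (diff \<eta> k)) has_derivative (\<lambda>d. h' k (diff \<eta> k) * diff d k)) (at \<eta>)" for k
    using has_derivative_compose[OF \<open>((\<lambda>\<eta>. diff \<eta> k) has_derivative _) _\<close> 
       assms[of k "diff \<eta> k", unfolded has_field_derivative_def]] by simp
  then have "((\<lambda>\<eta>. \<chi> k. h k (diff \<eta> k)) has_derivative (\<lambda>d. \<chi> k. h' k (diff \<eta> k) * diff d k)) (at \<eta>)"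
    by (subst has_derivative_componentwise_within) (auto simp: Basis_vec_def inner_axis)
  then have "((\<lambda>\<eta>. B *v (\<chi> k. h k (diff \<eta> k))) has_derivative
      (\<lambda>d. B *v (\<chi> k. h' k (diff \<eta> k) * diff d k))) (at \<eta>)"
    by (rule bounded_linear.has_derivative[OF matrix_vector_mul_bounded_linear])
  moreover have "((\<lambda>\<eta>. axis r (\<eta> $ r)) has_derivative (\<lambda>d. axis r (d $ r))) (at \<eta>)"
    by (intro bounded_linear_imp_has_derivative linear_conv_bounded_linear[THEN iffD1] linearI)
      (auto simp: axis_def vec_eq_iff)
  ultimately show ?thesis unfolding outflow_def[abs_def] by (rule has_derivative_add)
qed

text \<open>
  Pairing the difference of two values with \<open>\<eta> - \<xi>\<close> gives a sum of nonnegative terms, one for each line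
  and the square of the difference at \<open>r\<close>. If the values agree, all terms vanish; then \<open>\<eta> - \<xi>\<close> is
  constant along the lines, hence constant by connectedness, and zero at \<open>r\<close>.
\<close>

lemma inj_outflow:
  assumes connected: "\<And>S. S \<noteq> {} \<Longrightarrow> S \<noteq> UNIV \<Longrightarrow> cut src tgt S \<noteq> {}"
    and mono: "\<And>k. strict_mono (h k)"
  shows "inj (outflow h r)"
proof (rule injI)
  fix \<eta> \<xi> assume eq: "outflow h r \<eta> = outflow h r \<xi>"
  let ?d = "\<eta> - \<xi>"
  have diff_d: "diff ?d k = diff \<eta> k - diff \<xi> k" for k by (simp add: diff_def)
  have sgn: "0 \<le> (h k x - h k y) * (x - y)" "(h k x - h k y) * (x - y) = 0 \<longleftrightarrow> x = y" for k x y
    using strict_mono_less[OF mono[of k], of x y] strict_mono_eq[OF mono[of k], of x y]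
    by (cases x y rule: linorder_cases; auto simp: zero_le_mult_iff)+
  have "(\<Sum>k\<in>UNIV. (h k (diff \<eta> k) - h k (diff \<xi> k)) * (diff \<eta> k - diff \<xi> k)) + ?d $ r * ?d $ r
      = (outflow h r \<eta> - outflow h r \<xi>) \<bullet> ?d"
    by (simp add: inner_diff_left inner_outflow diff_d left_diff_distrib sum_subtractf)
  also have "\<dots> = 0" using eq by simp
  finally have "(\<Sum>k\<in>UNIV. (h k (diff \<eta> k) - h k (diff \<xi> k)) * (diff \<eta> k - diff \<xi> k)) = 0"
    and "?d $ r * ?d $ r = 0"
    using sum_nonneg[of UNIV "\<lambda>k. (h k (diff \<eta> k) - h k (diff \<xi> k)) * (diff \<eta> k - diff \<xi> k)"] sgn(1)
      zero_le_square[of "?d $ r"] by (smt (verit))+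
  then have "(h k (diff \<eta> k) - h k (diff \<xi> k)) * (diff \<eta> k - diff \<xi> k) = 0"
    and "?d $ r = 0" for k
    using sgn(1) by (simp_all only: sum_nonneg_eq_0_iff finite UNIV_I ball_UNIV mult_eq_0_iff) blast+
  then have "diff \<eta> k = diff \<xi> k" "?d $ r = 0" for k
    using sgn(2) by blast+
  then have "?d = 0" by (intro diff_injective[OF connected]) (auto simp: diff_d)
  then show "\<eta> = \<xi>" by simp
qed

text \<open>
  The derivative of the outflow map is the outflow map of the linear characteristics
  \<open>z \<mapsto> h' k (diff \<eta> k) * z\<close>. These are strictly increasing as well, so the injectivity
  lemma applies to the derivative too, and the inverse function theorem gives the claim.
\<close>

lemma inv_outflow_differentiable:
  assumes connected: "\<And>S. S \<noteq> {} \<Longrightarrow> S \<noteq> UNIV \<Longrightarrow> cut src tgt S \<noteq> {}"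
    and deriv: "\<And>k y. (h k has_real_derivative h' k y) (at y)" and pos: "\<And>k y. 0 < h' k y"
  shows "inv (outflow h r) differentiable at (outflow h r \<eta>)"
proof -
  let ?L = "outflow (\<lambda>k z. h' k (diff \<eta> k) * z) r"
  have mono: "strict_mono (h k)" for k
  proof (rule strict_monoI)
    show "h k x < h k y" if "x < y" for x y
      using deriv[of k] pos[of k] by (metis that DERIV_pos_imp_increasing)
  qed
  have L: "(outflow h r has_derivative ?L) (at \<eta>)"
    by (rule has_derivative_outflow[OF deriv])
  have "inj ?L"
    using pos by (intro inj_outflow[OF connected] strict_monoI) auto
  then obtain L' where "\<forall>x. ?L (L' x) = x"
    using linear_injective_isomorphism[OF has_derivative_linear[OF L]] by blast
  then have "?L \<circ> L' = id" by (auto simp: fun_eq_iff)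
  moreover have "continuous_on UNIV (outflow h r)"
    using has_derivative_outflow[OF deriv]
    by (meson continuous_at_imp_continuous_on has_derivative_continuous)
  ultimately have "(inv (outflow h r) has_derivative L') (at (outflow h r \<eta>))"
    using inj_outflow[OF connected mono] L
    by (intro has_derivative_inverse_strong[of UNIV \<eta> "outflow h r"]) auto
  then show ?thesis unfolding differentiable_def by blast
qed

text \<open>
  The field \<open>outflow h r \<eta> + p\<close> points outwards on a large sphere: its pairing with \<open>\<eta>\<close> is bounded
  below, by coercivity and \<open>cut_integral\<close>, by the oscillation of \<open>\<eta>\<close> and the square of the
  grounded potential, hence by every \<open>\<bar>\<eta> $ i\<bar>\<close> up to constants.
\<close>

lemma outflow_attains:
  fixes a C :: "'m \<Rightarrow> real" and p :: "real ^ 'n"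
  assumes cont: "continuous_on UNIV (outflow h r)"
    and coercive: "\<And>k y. a k * \<bar>y\<bar> - C k \<le> h k y * y"
    and cuts: "\<And>S. S \<noteq> {} \<Longrightarrow> S \<noteq> UNIV \<Longrightarrow> e \<le> sum a (cut src tgt S) + (\<Sum>i\<in>S. p $ i)"
    and e: "0 < e" and balanced: "(\<Sum>i\<in>UNIV. p $ i) = 0"
  shows "\<exists>\<eta>. outflow h r \<eta> = - p"
proof -
  define c where "c = \<bar>sum C UNIV\<bar> + e\<^sup>2"
  define R where "R = real CARD('n) * c / e + 1"
  have c: "0 \<le> c" by (simp add: c_def)
  have R: "0 < R" using e c unfolding R_def by (simp add: add_nonneg_pos)
  have "0 \<le> (outflow h r \<eta> + p) \<bullet> \<eta>" if "norm \<eta> = R" for \<eta>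
  proof -
    let ?T = "(outflow h r \<eta> + p) \<bullet> \<eta>"
    have node: "e * \<bar>\<eta> $ i\<bar> - c \<le> ?T" for i
    proof -
      have "(\<Sum>k\<in>UNIV. a k * \<bar>diff \<eta> k\<bar>) - sum C UNIV \<le> (\<Sum>k\<in>UNIV. h k (diff \<eta> k) * diff \<eta> k)"
        unfolding sum_subtractf[symmetric] by (intro sum_mono coercive)
      then have "e * \<bar>\<eta> $ i - \<eta> $ r\<bar> - sum C UNIV + (\<eta> $ r)\<^sup>2 \<le> ?T"
        using cut_integral[OF cuts less_imp_le[OF e] balanced, of \<eta> i r]
        by (simp add: inner_add_left inner_outflow power2_eq_square)
      moreover have "e * \<bar>\<eta> $ i\<bar> - e * \<bar>\<eta> $ r\<bar> \<le> e * \<bar>\<eta> $ i - \<eta> $ r\<bar>"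
        using e abs_triangle_ineq2[of "\<eta> $ i" "\<eta> $ r"]
        by (metis mult_left_mono less_imp_le right_diff_distrib)
      \<comment> \<open>The square from the grounding absorbs the loss \<open>e * \<bar>\<eta> $ r\<bar>\<close> in the triangle inequality.\<close>
      moreover have "0 \<le> (\<bar>\<eta> $ r\<bar> - e)\<^sup>2 + e * \<bar>\<eta> $ r\<bar>" using e by simp
      then have "e * \<bar>\<eta> $ r\<bar> - e\<^sup>2 \<le> (\<eta> $ r)\<^sup>2" by (simp add: power2_diff algebra_simps)
      ultimately show ?thesis unfolding c_def by linarith
    qed
    \<comment> \<open>Sum the bound over all nodes, because \<open>R\<close> is at most the sum of the \<open>\<bar>\<eta> $ i\<bar>\<close>.\<close>
    have "real CARD('n) * c \<le> e * R" using e unfolding R_def by (simp add: field_simps)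
    also have "\<dots> \<le> (\<Sum>i\<in>UNIV. e * \<bar>\<eta> $ i\<bar>)"
      using e that norm_le_l1_cart[of \<eta>] by (simp flip: sum_distrib_left)
    also have "\<dots> \<le> (\<Sum>i\<in>(UNIV::'n set). ?T + c)"
      using node by (intro sum_mono) (simp add: algebra_simps)
    finally have "real CARD('n) * c \<le> real CARD('n) * (?T + c)" by simp
    then have "c \<le> ?T + c" by (rule mult_left_le_imp_le) simp
    then show ?thesis by simp
  qed
  then have "\<exists>\<eta>. outflow h r \<eta> + p = 0"
    using R continuous_on_subset[OF cont]
    by (intro zero_of_outward_field[of R]) (auto intro!: continuous_intros)
  then show ?thesis by (auto simp: eq_neg_iff_add_eq_0)
qed

text \<open>
  A set and its complement have the same cut and opposite supplies. Were the cut empty, both supplies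
  would have to be positive.
\<close>

lemma connected_if_cuts_strict:
  fixes a :: "'m \<Rightarrow> real" and p :: "real ^ 'n"
  assumes cuts: "\<And>S. S \<noteq> {} \<Longrightarrow> S \<noteq> UNIV \<Longrightarrow> e \<le> sum a (cut src tgt S) + (\<Sum>i\<in>S. p $ i)"
    and e: "0 < e" and balanced: "(\<Sum>i\<in>UNIV. p $ i) = 0"
    and S: "S \<noteq> {}" "S \<noteq> UNIV"
  shows "cut src tgt S \<noteq> {}"
proof
  assume empty: "cut src tgt S = {}"
  moreover have "cut src tgt (- S) = cut src tgt S" by (auto simp: cut_def)
  ultimately have "e \<le> (\<Sum>i\<in>S. p $ i)" "e \<le> (\<Sum>i\<in>- S. p $ i)"
    using cuts[of S] cuts[of "- S"] S by auto
  moreover have "(\<Sum>i\<in>S. p $ i) + (\<Sum>i\<in>- S. p $ i) = 0"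
    using balanced sum.union_disjoint[of S "- S" "\<lambda>i. p $ i"] by (simp add: Compl_partition)
  ultimately show False using e by simp
qed

text \<open>
  Coercivity is only available strictly below the capacities. Giving up half of the margin \<open>e\<close>, shared
  equally among the lines, leaves room for this; an infinite capacity may be replaced by any number
  exceeding the total supply by the margin.
\<close>

lemma real_capacities:
  fixes p :: "real ^ 'n"
  assumes pos: "\<And>k. 0 < cap k" and e: "0 < e"
    and cuts: "\<And>S. S \<noteq> {} \<Longrightarrow> S \<noteq> UNIV \<Longrightarrow>
      - cut_capacity src tgt cap S + ereal e \<le> ereal (\<Sum>i\<in>S. p $ i)"
  obtains a where "\<And>k. 0 \<le> a k" "\<And>k. ereal (a k) < cap k"
    "\<And>S. S \<noteq> {} \<Longrightarrow> S \<noteq> UNIV \<Longrightarrow> e / 2 \<le> sum a (cut src tgt S) + (\<Sum>i\<in>S. p $ i)"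
proof -
  define slack where "slack = e / (2 * real CARD('m))"
  define K where "K = (\<Sum>i\<in>UNIV. \<bar>p $ i\<bar>) + e"
  define a where "a k = (if cap k = \<infinity> then K else max 0 (real_of_ereal (cap k) - slack))" for k
  have slack: "0 < slack" unfolding slack_def using e by simp
  have K: "0 \<le> K" unfolding K_def using e by (simp add: sum_nonneg)
  show ?thesis
  proof
    show a: "0 \<le> a k" for k using K by (simp add: a_def)
    show "ereal (a k) < cap k" for k
      using pos[of k] slack by (cases "cap k") (auto simp: a_def)
    fix S :: "'n set" assume S: "S \<noteq> {}" "S \<noteq> UNIV"
    let ?Q = "cut src tgt S" and ?p = "\<Sum>i\<in>S. p $ i"
    show "e / 2 \<le> sum a ?Q + ?p"
    proof (cases "\<exists>k\<in>?Q. cap k = \<infinity>")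
      case True
      then obtain k where "k \<in> ?Q" "cap k = \<infinity>" by blast
      then have "K \<le> sum a ?Q"
        using member_le_sum[of k ?Q a] a by (simp add: a_def)
      moreover have "- ?p \<le> (\<Sum>i\<in>UNIV. \<bar>p $ i\<bar>)"
      proof -
        have "- ?p \<le> (\<Sum>i\<in>S. \<bar>p $ i\<bar>)" by (simp flip: sum_negf) (intro sum_mono; simp)
        also have "\<dots> \<le> (\<Sum>i\<in>UNIV. \<bar>p $ i\<bar>)" by (intro sum_mono2) auto
        finally show ?thesis .
      qed
      ultimately show ?thesis using e by (simp add: K_def)
    next
      case False
      then have fin: "cap k = ereal (real_of_ereal (cap k))" if "k \<in> ?Q" for k
        using that pos[of k] by (cases "cap k") auto
      have "cut_capacity src tgt cap S = (\<Sum>k\<in>?Q. ereal (real_of_ereal (cap k)))"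
        unfolding cut_capacity_def by (intro sum.cong refl fin)
      then have "e - ?p \<le> (\<Sum>k\<in>?Q. real_of_ereal (cap k))"
        using cuts[OF S] by simp
      also have "\<dots> \<le> (\<Sum>k\<in>?Q. a k + slack)"
        using False by (intro sum_mono) (auto simp: a_def)
      also have "\<dots> \<le> sum a ?Q + real CARD('m) * slack"
        using slack card_mono[of UNIV ?Q] by (simp add: sum.distrib)
      also have "real CARD('m) * slack = e / 2" by (simp add: slack_def)
      finally show ?thesis by simp
    qed
  qed
qed

end

section \<open>Optimal routing along a supply trajectory\<close>

text \<open>
  On the open box of admissible flows all costs are finite, so there the real part of the total cost
  is the sum of the real parts.
\<close>

lemma gradient_total_cost:
  fixes F :: "'m::finite \<Rightarrow> real \<Rightarrow> ereal"
  assumes cost: "\<And>k. legendre_cost (cap k) (F k)" and l: "\<And>k. l $ k \<in> cap_interval (cap k)"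
  shows "GDERIV (\<lambda>x. real_of_ereal (total_cost F x)) l :> (\<chi> k. cost_deriv (F k) (l $ k))"
proof -
  let ?U = "\<Inter>k. (\<lambda>x. x $ k) -` cap_interval (cap k)"
  have open_U: "open ?U"
    by (intro open_INT ballI open_vimage open_cap_interval continuous_intros) simp
  have "((\<lambda>x. real_of_ereal (F k (x $ k))) has_derivative (\<lambda>d. cost_deriv (F k) (l $ k) * d $ k)) (at l)" for k
    using has_derivative_compose[OF bounded_linear_imp_has_derivative[OF bounded_linear_vec_nth]
        legendre_cost.cost_has_deriv[OF cost l, unfolded has_field_derivative_def]] .
  then have "((\<lambda>x. \<Sum>k\<in>UNIV. real_of_ereal (F k (x $ k))) has_derivative
      (\<lambda>d. \<Sum>k\<in>UNIV. cost_deriv (F k) (l $ k) * d $ k)) (at l)"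
    by (rule has_derivative_sum)
  then have "((\<lambda>x. real_of_ereal (total_cost F x)) has_derivative
      (\<lambda>d. \<Sum>k\<in>UNIV. cost_deriv (F k) (l $ k) * d $ k)) (at l)"
  proof (rule has_derivative_transform_within_open[OF _ open_U])
    show "l \<in> ?U" using l by simp
    fix x assume "x \<in> ?U"
    then show "(\<Sum>k\<in>UNIV. real_of_ereal (F k (x $ k))) = real_of_ereal (total_cost F x)"
      unfolding total_cost_def using legendre_cost.F_finite[OF cost]
      by (intro sum_real_of_ereal) auto
  qed
  moreover have "(\<lambda>d. \<Sum>k\<in>UNIV. cost_deriv (F k) (l $ k) * d $ k) = (\<lambda>d. d \<bullet> (\<chi> k. cost_deriv (F k) (l $ k)))"
    by (simp add: inner_vec_def mult.commute)
  ultimately show ?thesis unfolding gderiv_def by simp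
qed

lemma ode_solution_unique_if_state_independent:
  assumes "ode_solution (\<lambda>t z. g t) x" "ode_solution (\<lambda>t z. g t) y" "x 0 = y 0" "0 \<le> t"
  shows "x t = y t"
proof -
  have "((\<lambda>t. x t - y t) has_vector_derivative 0) (at t within {0..})" if "t \<in> {0..}" for t
    using assms(1,2) that has_vector_derivative_diff[of x "g t" "at t within {0..}" y "g t"]
    by (simp add: ode_solution_def)
  then obtain c where c: "\<And>t. t \<in> {0..} \<Longrightarrow> x t - y t = c"
    using has_vector_derivative_zero_constant[of "{0..}" "\<lambda>t. x t - y t"] by auto
  show ?thesis using c[of 0] c[of t] assms(3,4) by simp
qed

theorem proposition2:
  fixes src tgt :: "'m::finite \<Rightarrow> 'n::finite"
    and cap :: "'m \<Rightarrow> ereal"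
    and F :: "'m \<Rightarrow> real \<Rightarrow> ereal"
    and P :: "real ^ 'r::finite ^ 'n"
    and s :: "real ^ 'r \<Rightarrow> real ^ 'r"
    and W :: "(real ^ 'r) set"
  assumes no_loops: "\<And>k. src k \<noteq> tgt k"
    and cap_pos: "\<And>k. 0 < cap k"
    and W_compact: "compact W"
    and W_invariant: "forward_invariant s W"
    and balanced:
      "\<And>w t. exo_solution s w \<Longrightarrow> w 0 \<in> W \<Longrightarrow> t \<ge> 0 \<Longrightarrow>
         (1 :: real ^ 'n) \<bullet> (P *v w t) = 0"
    and cut_condition:
      "\<And>w. exo_solution s w \<Longrightarrow> w 0 \<in> W \<Longrightarrow>
         \<exists>\<epsilon>>0. \<forall>S. S \<noteq> {} \<and> S \<subset> UNIV \<longrightarrow> (\<forall>t\<ge>0.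
           - cut_capacity src tgt cap S + ereal \<epsilon> \<le> ereal (\<Sum>i\<in>S. (P *v w t) $ i) \<and>
           ereal (\<Sum>i\<in>S. (P *v w t) $ i) \<le> cut_capacity src tgt cap S - ereal \<epsilon>)"
    and legendre: "\<And>k. legendre_type (cap k) (F k)"
  shows "\<exists>(\<Phi> :: real ^ 'n \<Rightarrow> real ^ 'r \<Rightarrow> real ^ 'n) (\<Psi> :: real ^ 'n \<Rightarrow> real ^ 'm).
    \<forall>w. exo_solution s w \<and> w 0 \<in> W \<longrightarrow>
      (\<exists>\<zeta>0. \<exists>\<zeta>. ode_solution (\<lambda>t z. \<Phi> z (w t)) \<zeta> \<and> \<zeta> 0 = \<zeta>0 \<and>
         (\<forall>\<xi>. ode_solution (\<lambda>t z. \<Phi> z (w t)) \<xi> \<and> \<xi> 0 = \<zeta>0 \<longrightarrow> (\<forall>t\<ge>0. \<xi> t = \<zeta> t)) \<and>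
         (\<forall>t\<ge>0. (\<Psi> (\<zeta> t), w t) \<in> optimal_routing src tgt cap F P W))"
proof -
  interpret network src tgt by unfold_locales (rule no_loops)
  have cost: "legendre_cost (cap k) (F k)" for k
    using cap_pos legendre by unfold_locales
  define h where "h k = inv_into (cap_interval (cap k)) (cost_deriv (F k))" for k
  have deriv: "(h k has_real_derivative deriv (h k) y) (at y)" "0 < deriv (h k) y" for k y
    using legendre_cost.h_has_deriv[OF cost] legendre_cost.deriv_h_pos[OF cost]
    by (simp_all add: h_def)
  obtain r :: 'n where True by blast
  define E where "E = inv (outflow h r)"
  \<comment> \<open>Differentiating \<open>outflow h r (\<zeta> t) = - (P *v w t)\<close> in time forces this vector field. Where \<open>E\<close> fails
     to be differentiable its value is arbitrary; no trajectory gets there.\<close>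
  define \<Phi> where "\<Phi> = (\<lambda>(z :: real ^ 'n) w. frechet_derivative E (at (- (P *v w))) (- (P *v s w)))"
  define \<Psi> where "\<Psi> = (\<lambda>z. \<chi> k. h k (diff z k))"
  have "\<exists>\<zeta>. ode_solution (\<lambda>t z. \<Phi> z (w t)) \<zeta> \<and>
      (\<forall>\<xi>. ode_solution (\<lambda>t z. \<Phi> z (w t)) \<xi> \<and> \<xi> 0 = \<zeta> 0 \<longrightarrow> (\<forall>t\<ge>0. \<xi> t = \<zeta> t)) \<and>
      (\<forall>t\<ge>0. (\<Psi> (\<zeta> t), w t) \<in> optimal_routing src tgt cap F P W)"
    if w: "exo_solution s w" "w 0 \<in> W" for w
  proof -
    define \<zeta> where "\<zeta> t = E (- (P *v w t))" for t
    obtain \<epsilon> where \<epsilon>: "0 < \<epsilon>" and cuts: "\<And>S t. S \<noteq> {} \<Longrightarrow> S \<noteq> UNIV \<Longrightarrow> 0 \<le> t \<Longrightarrow>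
        - cut_capacity src tgt cap S + ereal \<epsilon> \<le> ereal (\<Sum>i\<in>S. (P *v w t) $ i)"
      using cut_condition[OF w] by blast
    have sum_zero: "(\<Sum>i\<in>UNIV. (P *v w t) $ i) = 0" if "0 \<le> t" for t
      using balanced[OF w that] by (simp add: inner_vec_def)
    have regular: "outflow h r (\<zeta> t) = - (P *v w t) \<and> E differentiable at (- (P *v w t))"
      if t: "0 \<le> t" for t
    proof -
      obtain a where a: "\<And>k. 0 \<le> a k" "\<And>k. ereal (a k) < cap k"
        "\<And>S. S \<noteq> {} \<Longrightarrow> S \<noteq> UNIV \<Longrightarrow> \<epsilon> / 2 \<le> sum a (cut src tgt S) + (\<Sum>i\<in>S. (P *v w t) $ i)"
        using real_capacities[OF cap_pos \<epsilon> cuts[OF _ _ t]] by metis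
      have "\<exists>C. \<forall>y. a k * \<bar>y\<bar> - C \<le> h k y * y" for k
        using legendre_cost.h_coercive[OF cost a(1,2)] by (simp add: h_def)
      then obtain C where C: "\<And>k y. a k * \<bar>y\<bar> - C k \<le> h k y * y" by metis
      have half: "0 < \<epsilon> / 2" using \<epsilon> by simp
      have cont: "continuous_on UNIV (outflow h r)"
        using has_derivative_outflow[OF deriv(1)]
        by (meson continuous_at_imp_continuous_on has_derivative_continuous)
      \<comment> \<open>The existence of some solution turns \<open>\<zeta> t\<close>, a value of \<open>E\<close>, into a solution.\<close>
      obtain \<eta> where \<eta>: "outflow h r \<eta> = - (P *v w t)"
        using outflow_attains[OF cont C a(3) half sum_zero[OF t]] by blast
      have connected: "cut src tgt S \<noteq> {}" if "S \<noteq> {}" "S \<noteq> UNIV" for S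
        using connected_if_cuts_strict[OF a(3) half sum_zero[OF t] that] .
      have "E differentiable at (outflow h r \<eta>)"
        unfolding E_def by (rule inv_outflow_differentiable[OF connected deriv])
      moreover have "outflow h r (\<zeta> t) = outflow h r \<eta>"
        unfolding \<zeta>_def E_def \<eta>[symmetric] by (intro f_inv_into_f) simp
      ultimately show ?thesis using \<eta> by simp
    qed
    have sol: "ode_solution (\<lambda>t z. \<Phi> z (w t)) \<zeta>"
      unfolding ode_solution_def
    proof (intro allI impI)
      fix t :: real assume t: "0 \<le> t"
      have "(w has_vector_derivative s (w t)) (at t within {0..})"
        using w(1) t by (simp add: exo_solution_def ode_solution_def)
      then have "((\<lambda>t. - (P *v w t)) has_vector_derivative - (P *v s (w t))) (at t within {0..})"
        by (intro has_vector_derivative_minus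
            bounded_linear.has_vector_derivative[OF matrix_vector_mul_bounded_linear])
      moreover have "(E has_derivative frechet_derivative E (at (- (P *v w t)))) (at (- (P *v w t)))"
        using regular[OF t] frechet_derivative_works by blast
      ultimately have "((E \<circ> (\<lambda>t. - (P *v w t))) has_vector_derivative
          frechet_derivative E (at (- (P *v w t))) (- (P *v s (w t)))) (at t within {0..})"
        by (intro vector_derivative_diff_chain_within) (auto intro: has_derivative_at_withinI)
      then show "(\<zeta> has_vector_derivative \<Phi> (\<zeta> t) (w t)) (at t within {0..})"
        by (simp add: \<Phi>_def \<zeta>_def[abs_def] o_def)
    qed
    have "(\<Psi> (\<zeta> t), w t) \<in> optimal_routing src tgt cap F P W" if t: "0 \<le> t" for t
    proof -
      have "w t \<in> W" using W_invariant w t unfolding forward_invariant_def by blast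
      moreover have inside: "\<Psi> (\<zeta> t) $ k \<in> cap_interval (cap k)" for k
        using legendre_cost.h_in[OF cost] by (simp add: \<Psi>_def h_def)
      moreover have "GDERIV (\<lambda>x. real_of_ereal (total_cost F x)) (\<Psi> (\<zeta> t))
          :> transpose B *v \<zeta> t"
      proof -
        have "(\<chi> k. cost_deriv (F k) (\<Psi> (\<zeta> t) $ k)) = transpose B *v \<zeta> t"
          using legendre_cost.D_h[OF cost]
          by (simp only: transpose_incidence) (simp add: \<Psi>_def h_def)
        then show ?thesis using gradient_total_cost[OF cost inside] by metis
      qed
      moreover have "B *v \<Psi> (\<zeta> t) + P *v w t = 0"
        using outflow_balance[of h r "\<zeta> t" "P *v w t"] regular[OF t] sum_zero[OF t]
        by (simp add: \<Psi>_def)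
      ultimately show ?thesis unfolding optimal_routing_def by blast
    qed
    moreover have "\<xi> t = \<zeta> t"
      if "ode_solution (\<lambda>t z. \<Phi> z (w t)) \<xi>" "\<xi> 0 = \<zeta> 0" "0 \<le> t" for \<xi> t
      using ode_solution_unique_if_state_independent[of "\<lambda>t. \<Phi> 0 (w t)" \<xi> \<zeta> t] that sol
      by (simp add: \<Phi>_def)
    ultimately show ?thesis using sol by blast
  qed
  then show ?thesis by blast
qed

end
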